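(* Let $H = C_5 + C_5 + C_5 + C_5 + C_5 + C_5$ be the Zykov sum of six disjoint copies of the $5$-cycle $C_5$. Then $H \to_e (3,3,3)$, i.e. for every coloring of the edges of $H$ in three colors there is a monochromatic triangle.
   Context: All graphs are finite, undirected, without loops or multiple edges. The Zykov sum $G_1+G_2$ of two vertex-disjoint graphs is the graph obtained from $G_1$ and $G_2$ by joining every vertex of $G_1$ to every vertex of $G_2$ (this operation is associative). For positive integers $a_1,\dots,a_r$, $G \to_e (a_1,\dots,a_r)$ means that for every coloring of $E(G)$ in $r$ colors there is some $i\in\{1,\dots,r\}$ and an $a_i$-clique all of whose edges have color $i$. *)

theory Defs
  imports Main
begin

text \<open>A finite simple graph: a vertex set together with a set of edges,
  each edge being a 2-element subset of the vertex set.\<close>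
type_synonym 'a graph = "'a set \<times> 'a set set"

definition verts :: "'a graph \<Rightarrow> 'a set" where "verts G = fst G"
definition edges :: "'a graph \<Rightarrow> 'a set set" where "edges G = snd G"

definition C5 :: "nat graph" where
  "C5 = ({0..<5}, {{j, (j + 1) mod 5} | j. j < 5})"

definition tag_copy :: "nat \<Rightarrow> 'a graph \<Rightarrow> (nat \<times> 'a) graph" where
  "tag_copy k G = (Pair k ` verts G, (\<lambda>e. Pair k ` e) ` edges G)"

text \<open>Zykov sum (join) of two graphs (intended for vertex-disjoint arguments).\<close>
definition zykov_sum :: "'a graph \<Rightarrow> 'a graph \<Rightarrow> 'a graph" where
  "zykov_sum G1 G2 = (verts G1 \<union> verts G2,
     edges G1 \<union> edges G2 \<union> {{u, v} | u v. u \<in> verts G1 \<and> v \<in> verts G2})"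

fun zykov_power :: "nat \<Rightarrow> 'a graph \<Rightarrow> (nat \<times> 'a) graph" where
  "zykov_power 0 G = ({}, {})"
| "zykov_power (Suc n) G = zykov_sum (zykov_power n G) (tag_copy n G)"

definition edge_arrows :: "'a graph \<Rightarrow> nat list \<Rightarrow> bool" where
  "edge_arrows G as \<longleftrightarrow>
     (\<forall>c :: 'a set \<Rightarrow> nat. (\<forall>e\<in>edges G. c e < length as) \<longrightarrow>
        (\<exists>i < length as. \<exists>K \<subseteq> verts G. card K = as ! i \<and>
            (\<forall>u\<in>K. \<forall>v\<in>K. u \<noteq> v \<longrightarrow> {u, v} \<in> edges G \<and> c {u, v} = i)))"

end

theory Submission
  imports Defs
begin

text \<open>
  Suppose the edges are 3-coloured without monochromatic triangle. The \<open>c\<close>-coloured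
  neighbourhood \<open>W\<close> of a vertex spans only the other two colours. Both \<open>K\<^sub>6\<close> and \<open>K\<^sub>3 + C\<^sub>5\<close> arrow
  \<open>(3, 3)\<close>, so \<open>W\<close> has chromatic number at most 5 or is exactly the union of two fibers
  (copies of \<open>C\<^sub>5\<close>). The full neighbourhood has chromatic number 16, and if the two fiber edges at
  the vertex had different colours, the three parts would need 17 colours in total, although
  neither of the parts meeting the vertex's own fiber could be a union of two fibers. Therefore
  every fiber is monochromatic, and every vertex is joined in some colour, different from that of
  its own fiber, to exactly two full fibers; these two have a common colour. Sorting the six fibers
  by colour leaves the distributions with a class of at least 4, 3+3, 3+2+1 and 2+2+2, and each of
  them is contradictory.
\<close>

section \<open>The 5-cycle and cliques in the join\<close>

definition nxt :: "nat \<Rightarrow> nat" where "nxt j = (j + 1) mod 5"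

lemma nxt_simps [simp]: "nxt 0 = 1" "nxt (Suc 0) = 2" "nxt 1 = 2" "nxt 2 = 3" "nxt 3 = 4" "nxt 4 = 0"
  by (simp_all add: nxt_def)

lemma nxt_less [simp]: "nxt j < 5"
  by (simp add: nxt_def)

lemma ex_less_5: "(\<exists>j<5. P j) \<longleftrightarrow> P 0 \<or> P 1 \<or> P 2 \<or> P 3 \<or> P (4::nat)"
  by (simp add: eval_nat_numeral Ex_less_Suc disj_ac)

lemma all_less_5: "(\<forall>j<5. P j) \<longleftrightarrow> P 0 \<and> P 1 \<and> P 2 \<and> P 3 \<and> P (4::nat)"
  by (simp add: eval_nat_numeral All_less_Suc conj_ac)

definition has_edge :: "nat set \<Rightarrow> bool" where
  "has_edge S \<longleftrightarrow> (\<exists>j<5. j \<in> S \<and> nxt j \<in> S)"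

text \<open>If neither set contained an edge, membership in \<open>S\<close> would alternate around
  a cycle of odd length. The sets may overlap, so the lemma also applies to links seen from two
  different vertices.\<close>

lemma C5_not_2_colorable:
  assumes "{..<5} \<subseteq> S \<union> T"
  shows "has_edge S \<or> has_edge T"
proof -
  have "\<forall>j<5. j \<in> S \<or> j \<in> T" using assms by auto
  then show ?thesis unfolding has_edge_def ex_less_5 all_less_5 nxt_simps by blast
qed

text \<open>The chromatic number of the subgraph of \<open>C5\<close> induced by \<open>S\<close>, for \<open>S \<subseteq> {..<5}\<close>.\<close>
definition chi :: "nat set \<Rightarrow> nat" where
  "chi S = (if {..<5} \<subseteq> S then 3 else if has_edge S then 2 else if S = {} then 0 else 1)"

lemma chi_le: "chi S \<le> 3"
  by (simp add: chi_def)

lemma chi_eq_0: "chi S = 0 \<longleftrightarrow> S = {}"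
proof -
  have "\<not> {..<5::nat} \<subseteq> {}" by (auto simp: lessThan_empty_iff)
  then show ?thesis by (auto simp: chi_def has_edge_def)
qed

lemma chi_eq_3: "chi S = 3 \<longleftrightarrow> {..<5} \<subseteq> S"
  by (simp add: chi_def)

lemma chi_ge_2: "chi S \<ge> 2 \<Longrightarrow> has_edge S"
proof (cases "{..<5} \<subseteq> S")
  case True
  then have "0 \<in> S" "1 \<in> S" by auto
  then show ?thesis unfolding has_edge_def by (intro exI[of _ 0]) simp
qed (auto simp: chi_def split: if_splits)

text \<open>Subadditivity of the chromatic number. Three nonempty parts count at least 1 each. If a
  part is empty, the other two cover the cycle: either one of them is the whole cycle, or one
  contains an edge and counts 2 while the other counts at least 1.\<close>

lemma chi_cover:
  assumes "{..<5} \<subseteq> S \<union> T \<union> U"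
  shows "chi S + chi T + chi U \<ge> 3"
proof (rule ccontr)
  assume less: "\<not> ?thesis"
  have two: False if "{..<5} \<subseteq> X \<union> Y" "chi X + chi Y < 3" for X Y
  proof -
    have "X \<noteq> {}" "Y \<noteq> {}"
      using that by (auto simp: chi_def)
    then have "chi X > 0" "chi Y > 0" using chi_eq_0 by auto
    moreover have "chi X \<ge> 2 \<or> chi Y \<ge> 2"
      using C5_not_2_colorable[OF that(1)] by (auto simp: chi_def)
    ultimately show False using that(2) by linarith
  qed
  show False
  proof (cases "S = {} \<or> T = {} \<or> U = {}")
    case True
    then show False using two[of T U] two[of S U] two[of S T] assms less by auto
  next
    case False
    then have "chi S > 0" "chi T > 0" "chi U > 0" using chi_eq_0 by auto
    then show False using less by linarith
  qed
qed

text \<open>Adjacency in \<open>zykov_power 6 C5\<close> in coordinates, the copy first and the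
  position on the cycle second; \<open>adj_edge\<close> makes the connection. With the bounds
  included, \<open>adj\<close> alone certifies both ends as vertices.\<close>

definition adj :: "nat \<times> nat \<Rightarrow> nat \<times> nat \<Rightarrow> bool" where
  "adj u v \<longleftrightarrow> fst u < 6 \<and> fst v < 6 \<and> snd u < 5 \<and> snd v < 5 \<and>
     (fst u \<noteq> fst v \<or> snd v = nxt (snd u) \<or> snd u = nxt (snd v))"

lemma nxt_neq: "j < 5 \<Longrightarrow> nxt j \<noteq> j"
  using all_less_5[of "\<lambda>j. nxt j \<noteq> j"] by simp

lemma adj_irrefl: "adj u v \<Longrightarrow> u \<noteq> v"
  using nxt_neq[of "snd u"] by (auto simp: adj_def)

lemma adj_nxt: "i < 6 \<Longrightarrow> j < 5 \<Longrightarrow> adj (i, j) (i, nxt j)"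
  by (simp add: adj_def)

lemma adj_fiber: "i < 6 \<Longrightarrow> k < 6 \<Longrightarrow> i \<noteq> k \<Longrightarrow> j < 5 \<Longrightarrow> l < 5 \<Longrightarrow> adj (i, j) (k, l)"
  by (simp add: adj_def)

definition clique :: "(nat \<times> nat) set \<Rightarrow> bool" where
  "clique K \<longleftrightarrow> (\<forall>u\<in>K. \<forall>v\<in>K. u \<noteq> v \<longrightarrow> adj u v)"

lemma cliqueD: "clique K \<Longrightarrow> u \<in> K \<Longrightarrow> v \<in> K \<Longrightarrow> u \<noteq> v \<Longrightarrow> adj u v"
  by (simp add: clique_def)

definition slice :: "(nat \<times> nat) set \<Rightarrow> nat \<Rightarrow> nat set" where
  "slice W k = {j. j < 5 \<and> (k, j) \<in> W}"

text \<open>A full fiber has chromatic number 3 but no triangle, hence the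
  \<open>min\<close>.\<close>

lemma clique_fiber:
  assumes "k < 6"
  shows "\<exists>K. K \<subseteq> W \<and> K \<subseteq> {k} \<times> {..<5} \<and> clique K \<and> card K = min 2 (chi (slice W k))"
proof -
  consider "chi (slice W k) \<ge> 2" | "chi (slice W k) = 1" | "chi (slice W k) = 0" by linarith
  then show ?thesis
  proof cases
    case 1
    then obtain j where "j < 5" "j \<in> slice W k" "nxt j \<in> slice W k"
      using chi_ge_2 unfolding has_edge_def by blast
    moreover from this have "adj (k, j) (k, nxt j)" "adj (k, nxt j) (k, j)"
      using assms by (simp_all add: adj_def)
    ultimately show ?thesis using 1 nxt_neq[of j]
      by (intro exI[of _ "{(k, j), (k, nxt j)}"]) (auto simp: slice_def clique_def)
  next
    case 2
    then have "slice W k \<noteq> {}" using chi_eq_0[of "slice W k"] by auto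
    then obtain j where "j \<in> slice W k" by blast
    then show ?thesis using 2
      by (intro exI[of _ "{(k, j)}"]) (auto simp: slice_def clique_def)
  qed (auto intro!: exI[of _ "{}"] simp: clique_def)
qed

text \<open>Distinct fibers are completely joined, so cliques of the single fibers unite to one
  clique.\<close>

lemma clique_fibers:
  assumes "finite I" "I \<subseteq> {..<6}"
  shows "\<exists>K. K \<subseteq> W \<and> K \<subseteq> I \<times> {..<5} \<and> clique K \<and> card K = (\<Sum>k\<in>I. min 2 (chi (slice W k)))"
  using assms
proof (induction I rule: finite_induct)
  case empty
  then show ?case by (auto intro!: exI[of _ "{}"] simp: clique_def)
next
  case (insert k I)
  then obtain K where K: "K \<subseteq> W" "K \<subseteq> I \<times> {..<5}" "clique K"
    "card K = (\<Sum>k\<in>I. min 2 (chi (slice W k)))" by auto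
  obtain L where L: "L \<subseteq> W" "L \<subseteq> {k} \<times> {..<5}" "clique L" "card L = min 2 (chi (slice W k))"
    using clique_fiber[of k W] insert.prems by auto
  have fin: "finite K" "finite L"
    using finite_subset[OF K(2)] finite_subset[OF L(2)] insert.hyps(1) by auto
  have "K \<inter> L = {}" using K(2) L(2) insert.hyps(2) by auto
  then have card: "card (K \<union> L) = (\<Sum>k\<in>insert k I. min 2 (chi (slice W k)))"
    using fin K(4) L(4) insert.hyps by (simp add: card_Un_disjoint)
  have cross: "adj u v \<and> adj v u" if "u \<in> K" "v \<in> L" for u v
  proof -
    have "u \<in> I \<times> {..<5}" "v \<in> {k} \<times> {..<5}" using that K(2) L(2) by auto
    then show ?thesis using insert.hyps(2) insert.prems by (auto simp: adj_def)
  qed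
  have "clique (K \<union> L)" using K(3) L(3) cross unfolding clique_def by blast
  then show ?case using K L card by (intro exI[of _ "K \<union> L"]) auto
qed

section \<open>Neighbourhoods avoiding a colour\<close>

lemma ex_third_color: "\<exists>z<3. z \<noteq> a \<and> z \<noteq> (b::nat)"
proof -
  have "0 \<noteq> a \<and> 0 \<noteq> b \<or> 1 \<noteq> a \<and> 1 \<noteq> b \<or> 2 \<noteq> a \<and> 2 \<noteq> b" by linarith
  moreover have "0 < (3::nat)" "1 < (3::nat)" "2 < (3::nat)" by simp_all
  ultimately show ?thesis by blast
qed

text \<open>Colours are given on all pairs, adjacent or not, so that symmetry and the bound 3 carry
  no side conditions. The aim is to derive \<open>False\<close> inside the locale.\<close>

locale triangle_free_coloring =
  fixes col :: "nat \<times> nat \<Rightarrow> nat \<times> nat \<Rightarrow> nat"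
  assumes col_sym: "col u v = col v u"
    and col_less: "col u v < 3"
    and no_triangle: "\<lbrakk>adj u v; adj u w; adj v w; col u v = c; col u w = c; col v w = c\<rbrakk> \<Longrightarrow> False"
begin

definition avoids :: "(nat \<times> nat) set \<Rightarrow> nat \<Rightarrow> bool" where
  "avoids W c \<longleftrightarrow> (\<forall>u\<in>W. \<forall>v\<in>W. adj u v \<longrightarrow> col u v \<noteq> c)"

lemma avoidsD: "avoids W c \<Longrightarrow> u \<in> W \<Longrightarrow> v \<in> W \<Longrightarrow> adj u v \<Longrightarrow> col u v \<noteq> c"
  by (simp add: avoids_def)

lemma other_colors:
  assumes "c < 3"
  obtains p q where "p \<noteq> q" "p \<noteq> c" "q \<noteq> c" "\<And>u v. col u v \<noteq> c \<Longrightarrow> col u v = p \<or> col u v = q"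
proof -
  have "\<exists>p q. p \<noteq> q \<and> p \<noteq> c \<and> q \<noteq> c \<and> (\<forall>x<3. x \<noteq> c \<longrightarrow> x = p \<or> x = q)"
    using assms
    by (intro exI[of _ "if c = 0 then 1 else 0"] exI[of _ "if c = 2 then 1 else 2"]) auto
  then show ?thesis using that col_less by blast
qed

text \<open>The Ramsey bound R(3,3) = 6 for the two colours other than \<open>c\<close>: among five
  edges at \<open>x\<close> three share a colour, and their far ends span a further edge of that
  colour or a triangle in the other one.\<close>

lemma avoiding_clique_card:
  assumes "c < 3" "avoids K c" "clique K" "finite K"
  shows "card K < 6"
proof (rule ccontr)
  assume "\<not> ?thesis"
  then have "card K \<ge> 6" by simp
  then obtain x where x: "x \<in> K" by (metis card.empty ex_in_conv not_numeral_le_zero)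
  obtain p q where pq: "p \<noteq> q" "p \<noteq> c" "q \<noteq> c" "\<And>u v. col u v \<noteq> c \<Longrightarrow> col u v = p \<or> col u v = q"
    using other_colors[OF assms(1)] by metis
  have no3: False if M: "card M \<ge> 3" "M \<subseteq> K - {x}" "\<And>y. y \<in> M \<Longrightarrow> col x y = r" "r \<noteq> s"
    "\<And>u v. col u v \<noteq> c \<Longrightarrow> col u v = r \<or> col u v = s" for M r s
  proof -
    obtain M' where M': "M' \<subseteq> M" "card M' = 3" using M(1) by (metis obtain_subset_with_card_n)
    then obtain y1 y2 y3 where "M' = {y1, y2, y3}" and neq: "y1 \<noteq> y2" "y1 \<noteq> y3" "y2 \<noteq> y3"
      by (meson card_3_iff)
    then have y: "y1 \<in> M" "y2 \<in> M" "y3 \<in> M" using M'(1) by simp_all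
    have adj_x: "adj x u" if "u \<in> M" for u
      using cliqueD[OF assms(3) x, of u] that M(2) by blast
    have s: "col u v = s" "adj u v" if "u \<in> M" "v \<in> M" "u \<noteq> v" for u v
    proof -
      show "adj u v" using cliqueD[OF assms(3), of u v] that M(2) by blast
      have "col u v \<noteq> r"
        using no_triangle[OF adj_x[OF that(1)] adj_x[OF that(2)] \<open>adj u v\<close> M(3)[OF that(1)] M(3)[OF that(2)]]
        by blast
      moreover have "col u v \<noteq> c" using assms(2) that M(2) \<open>adj u v\<close> unfolding avoids_def by blast
      ultimately show "col u v = s" using M(5) by blast
    qed
    show False
      using no_triangle[OF s(2) s(2) s(2) s(1) s(1) s(1), of y1 y2 y3] y neq by simp
  qed
  let ?P = "{y \<in> K - {x}. col x y = p}" and ?Q = "{y \<in> K - {x}. col x y = q}"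
  have "K - {x} \<subseteq> ?P \<union> ?Q"
  proof
    fix y assume y: "y \<in> K - {x}"
    then have "adj x y" using cliqueD[OF assms(3) x, of y] by blast
    then have "col x y = p \<or> col x y = q"
      using pq(4) avoidsD[OF assms(2) x, of y] y by blast
    then show "y \<in> ?P \<union> ?Q" using y by blast
  qed
  then have "card (K - {x}) \<le> card (?P \<union> ?Q)" using assms(4) by (intro card_mono) auto
  also have "\<dots> \<le> card ?P + card ?Q" by (rule card_Un_le)
  finally have "card ?P \<ge> 3 \<or> card ?Q \<ge> 3" using \<open>card K \<ge> 6\<close> x assms(4) by auto
  then show False
  proof
    assume "card ?P \<ge> 3"
    then show False by (rule no3[of ?P p q]) (use pq in blast)+
  next
    assume "card ?Q \<ge> 3"
    then show False by (rule no3[of ?Q q p]) (use pq in blast)+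
  qed
qed

text \<open>Some vertex \<open>x\<close> of the triangle sends one colour \<open>r\<close> to both
  \<open>y\<close> and \<open>z\<close>, so the edge \<open>y z\<close> has the other colour
  \<open>s\<close>. A fiber vertex joined to \<open>x\<close> in \<open>r\<close> would be joined to
  \<open>y\<close> and \<open>z\<close> in \<open>s\<close>, so \<open>x\<close> sends only
  \<open>s\<close> to the fiber and all fiber edges have colour \<open>r\<close>. The
  \<open>r\<close>-links of \<open>y\<close> and \<open>z\<close> are then independent, yet cover
  the fiber because \<open>y z\<close> has colour \<open>s\<close>.\<close>

lemma avoiding_triangle_plus_fiber:
  assumes "c < 3" "avoids W c" "k < 6" "{k} \<times> {..<5} \<subseteq> W" "K \<subseteq> W" "clique K" "card K = 3"
    "\<And>v. v \<in> K \<Longrightarrow> fst v \<noteq> k"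
  shows False
proof -
  obtain p q where pq: "p \<noteq> q" "p \<noteq> c" "q \<noteq> c" "\<And>u v. col u v \<noteq> c \<Longrightarrow> col u v = p \<or> col u v = q"
    using other_colors[OF assms(1)] by metis
  obtain y1 y2 y3 where y: "K = {y1, y2, y3}" "y1 \<noteq> y2" "y1 \<noteq> y3" "y2 \<noteq> y3"
    using assms(7) by (auto simp: card_3_iff)
  have col_cases: "col u v = p \<or> col u v = q" if "u \<in> W" "v \<in> W" "adj u v" for u v
    using pq(4)[OF avoidsD[OF assms(2) that]] .
  have adjK: "adj u v" if "u \<in> K" "v \<in> K" "u \<noteq> v" for u v
    using cliqueD[OF assms(6) that] .
  have adjF: "adj u (k, j)" if "u \<in> K" "j < 5" for u j
  proof -
    have "fst u < 6 \<and> snd u < 5"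
      using that(1) y(1) adjK[of y1 y2] adjK[of y1 y3] y by (auto simp: adj_def)
    then show ?thesis using assms(3,8) that by (auto simp: adj_def)
  qed
  have main: False if H: "x \<in> K" "y \<in> K" "z \<in> K" "x \<noteq> y" "x \<noteq> z" "y \<noteq> z"
    "col x y = r" "col x z = r" "r \<noteq> s" "\<And>u v. u \<in> W \<Longrightarrow> v \<in> W \<Longrightarrow> adj u v \<Longrightarrow> col u v = r \<or> col u v = s"
  for x y z r s
  proof -
    have W: "x \<in> W" "y \<in> W" "z \<in> W" and F: "\<And>j. j < 5 \<Longrightarrow> (k, j) \<in> W"
      using H assms(4,5) by auto
    have yz: "col y z = s"
      using H(10)[OF W(2,3) adjK[OF H(2,3,6)]]
        no_triangle[OF adjK[OF H(1,2,4)] adjK[OF H(1,3,5)] adjK[OF H(2,3,6)] H(7,8)] by blast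
    have rs: "col u (k, j) = r \<or> col u (k, j) = s" if "u \<in> K" "j < 5" for u j
      using H(10)[OF subsetD[OF assms(5) that(1)] F[OF that(2)] adjF[OF that]] .
    have tri: False if "u \<in> K" "v \<in> K" "u \<noteq> v" "j < 5" "col u v = t" "col u (k, j) = t" "col v (k, j) = t"
    for u v j t
      using no_triangle[OF adjK[OF that(1-3)] adjF[OF that(1,4)] adjF[OF that(2,4)] that(5-7)] .
    have xs: "col x (k, j) = s" if "j < 5" for j
    proof (rule ccontr)
      assume "col x (k, j) \<noteq> s"
      then have "col x (k, j) = r" using rs H(1) that by blast
      then have "col y (k, j) \<noteq> r" "col z (k, j) \<noteq> r"
        using tri[OF H(1,2,4) that H(7)] tri[OF H(1,3,5) that H(8)] by blast+
      then have "col y (k, j) = s" "col z (k, j) = s" using rs H(2,3) that by blast+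
      then show False using tri[OF H(2,3,6) that yz] by blast
    qed
    have Fr: "col (k, j) (k, nxt j) = r" if "j < 5" for j
    proof -
      have a: "adj (k, j) (k, nxt j)" using adj_nxt assms(3) that by blast
      have "col (k, j) (k, nxt j) \<noteq> s"
        using no_triangle[OF adjF[OF H(1) that] adjF[OF H(1) nxt_less] a xs[OF that] xs[OF nxt_less]]
        by blast
      then show ?thesis using H(10)[OF F[OF that] F[OF nxt_less] a] by blast
    qed
    have indep: "\<not> has_edge {j. col u (k, j) = r}" if "u \<in> K" for u
    proof
      assume "has_edge {j. col u (k, j) = r}"
      then obtain j where j: "j < 5" "col u (k, j) = r" "col u (k, nxt j) = r"
        by (auto simp: has_edge_def)
      show False
        using no_triangle[OF adjF[OF that j(1)] adjF[OF that nxt_less] adj_nxt[OF assms(3) j(1)] j(2,3) Fr[OF j(1)]] .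
    qed
    have "j \<in> {j. col y (k, j) = r} \<union> {j. col z (k, j) = r}" if "j < 5" for j
      using rs[OF H(2) that] rs[OF H(3) that] tri[OF H(2,3,6) that yz] by blast
    then have "{..<5} \<subseteq> {j. col y (k, j) = r} \<union> {j. col z (k, j) = r}" by blast
    then show False using C5_not_2_colorable indep H(2,3) by blast
  qed
  have c12: "col y1 y2 = p \<or> col y1 y2 = q" and c13: "col y1 y3 = p \<or> col y1 y3 = q"
    and c23: "col y2 y3 = p \<or> col y2 y3 = q"
    using col_cases[OF _ _ adjK] y assms(5) by simp_all
  \<comment> \<open>Equal colours at a common vertex are refuted by \<open>main\<close> with that
    vertex as \<open>x\<close>; three pairwise different colours do not fit into \<open>p\<close>
    and \<open>q\<close>.\<close>
  have eq: "col y1 y2 \<noteq> col y1 y3" "col y2 y1 \<noteq> col y2 y3" "col y3 y1 \<noteq> col y3 y2"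
  proof -
    have *: "col x y \<noteq> col x z" if "x \<in> K" "y \<in> K" "z \<in> K" "x \<noteq> y" "x \<noteq> z" "y \<noteq> z" for x y z
    proof
      assume e: "col x y = col x z"
      have "col x y = p \<or> col x y = q"
        using col_cases[OF _ _ adjK[OF that(1,2,4)]] that(1,2) assms(5) by blast
      then show False
      proof
        assume "col x y = p"
        then show False using e pq(1) col_cases by (intro main[OF that, of p q]) metis+
      next
        assume "col x y = q"
        then show False using e pq(1) col_cases by (intro main[OF that, of q p]) metis+
      qed
    qed
    show "col y1 y2 \<noteq> col y1 y3" "col y2 y1 \<noteq> col y2 y3" "col y3 y1 \<noteq> col y3 y2"
      by (rule *; use y in simp)+
  qed
  then show False using c12 c13 c23 col_sym[of y2 y1] col_sym[of y3 y1] col_sym[of y3 y2] by metis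
qed

text \<open>The exceptional case cannot be dropped: \<open>C\<^sub>5 + C\<^sub>5\<close> has chromatic number 6, but colouring
  both cycles red and all edges between them blue leaves no monochromatic triangle.\<close>
lemma chi_avoiding:
  assumes "c < 3" "avoids W c"
  shows "(\<Sum>k<6. chi (slice W k)) \<le> 5 \<or>
    (\<Sum>k<6. chi (slice W k)) = 6 \<and>
    (\<exists>a b. a < 6 \<and> b < 6 \<and> a \<noteq> b \<and> slice W a = {..<5} \<and> slice W b = {..<5} \<and>
      (\<forall>k<6. k \<noteq> a \<longrightarrow> k \<noteq> b \<longrightarrow> slice W k = {}))"
proof (cases "\<exists>a<6. chi (slice W a) = 3")
  case False
  \<comment> \<open>Without a full fiber no slice has chromatic number above 2, so the clique built
    from the fibers is as large as the whole sum.\<close>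
  then have eq: "min 2 (chi (slice W k)) = chi (slice W k)" if "k < 6" for k
    using chi_le[of "slice W k"] that by (cases "chi (slice W k) = 3") auto
  obtain K where K: "K \<subseteq> W" "K \<subseteq> {..<6} \<times> {..<5}" "clique K" "card K = (\<Sum>k<6. min 2 (chi (slice W k)))"
    using clique_fibers[of "{..<6}" W] by auto
  have "avoids K c" using assms(2) K(1) by (auto simp: avoids_def)
  moreover have "finite K" using finite_subset[OF K(2)] by auto
  ultimately have "card K < 6" using avoiding_clique_card assms(1) K(3) by blast
  then show ?thesis using K(4) eq by simp
next
  case True
  then obtain a where a: "a < 6" "chi (slice W a) = 3" by blast
  let ?I = "{..<6} - {a}"
  obtain K where K: "K \<subseteq> W" "K \<subseteq> ?I \<times> {..<5}" "clique K" "card K = (\<Sum>k\<in>?I. min 2 (chi (slice W k)))"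
    using clique_fibers[of ?I W] by auto
  have full: "slice W a = {..<5}" using a(2) by (auto simp: chi_eq_3 slice_def)
  \<comment> \<open>Three clique vertices outside the full fiber \<open>a\<close> would form with it
    a triangle joined to a 5-cycle.\<close>
  have small: "(\<Sum>k\<in>?I. min 2 (chi (slice W k))) \<le> 2"
  proof (rule ccontr)
    assume "\<not> ?thesis"
    then obtain L where L: "L \<subseteq> K" "card L = 3" using K(4)
      by (metis not_less_eq_eq numeral_2_eq_2 numeral_3_eq_3 obtain_subset_with_card_n)
    show False
    proof (rule avoiding_triangle_plus_fiber[OF assms a(1), of L])
      show "{a} \<times> {..<5} \<subseteq> W" using full by (auto simp: slice_def)
      show "clique L" using L(1) K(3) unfolding clique_def by blast
    qed (use L K(1,2) in auto)
  qed
  have sum: "(\<Sum>k<6. chi (slice W k)) = 3 + (\<Sum>k\<in>?I. chi (slice W k))"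
    using a sum.remove[of "{..<6}" a "\<lambda>k. chi (slice W k)"] by auto
  show ?thesis
  proof (cases "\<exists>b\<in>?I. chi (slice W b) = 3")
    case False
    have "min 2 (chi (slice W k)) = chi (slice W k)" if "k \<in> ?I" for k
    proof -
      have "chi (slice W k) \<noteq> 3" using False that by blast
      then show ?thesis using chi_le[of "slice W k"] by simp
    qed
    then have "(\<Sum>k\<in>?I. chi (slice W k)) = (\<Sum>k\<in>?I. min 2 (chi (slice W k)))"
      by (intro sum.cong) auto
    then show ?thesis using sum small by linarith
  next
    case True
    \<comment> \<open>A second full fiber already exhausts the bound 2, so every further slice is
      empty.\<close>
    then obtain b where b: "b \<in> ?I" "chi (slice W b) = 3" by blast
    then have "(\<Sum>k\<in>?I. min 2 (chi (slice W k))) = 2 + (\<Sum>k\<in>?I - {b}. min 2 (chi (slice W k)))"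
      using sum.remove[of ?I b "\<lambda>k. min 2 (chi (slice W k))"] by auto
    then have "(\<Sum>k\<in>?I - {b}. min 2 (chi (slice W k))) = 0" using small by linarith
    then have zero: "slice W k = {}" if "k \<in> ?I - {b}" for k
    proof -
      have "min 2 (chi (slice W k)) = 0"
        using \<open>_ = 0\<close> that by (subst (asm) sum_eq_0_iff) blast+
      then show ?thesis using chi_eq_0[of "slice W k"] by (simp add: min_def split: if_splits)
    qed
    have "(\<Sum>k\<in>?I. chi (slice W k)) = 3 + (\<Sum>k\<in>?I - {b}. chi (slice W k))"
      using sum.remove[of ?I b "\<lambda>k. chi (slice W k)"] b by auto
    also have "\<dots> = 3" using zero chi_eq_0 by simp
    finally have "(\<Sum>k<6. chi (slice W k)) = 6" using sum by simp
    moreover have "slice W b = {..<5}" using b(2) by (auto simp: chi_eq_3 slice_def)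
    moreover have "\<forall>k<6. k \<noteq> a \<longrightarrow> k \<noteq> b \<longrightarrow> slice W k = {}" using zero by blast
    moreover have "a \<noteq> b" "b < 6" using b(1) by simp_all
    ultimately show ?thesis using full a(1) by blast
  qed
qed

text \<open>One edge from each of three fibers gives a clique of size 6 without colour
  \<open>c\<close>.\<close>

lemma avoiding_three_edges:
  assumes "c < 3" "avoids W c" "I \<subseteq> {..<6}" "card I \<ge> 3" "\<And>k. k \<in> I \<Longrightarrow> has_edge (slice W k)"
  shows False
proof -
  have fin: "finite I" using assms(3) finite_subset by blast
  obtain K where K: "K \<subseteq> W" "K \<subseteq> I \<times> {..<5}" "clique K" "card K = (\<Sum>k\<in>I. min 2 (chi (slice W k)))"
    using clique_fibers[OF fin assms(3), of W] by auto
  have "min 2 (chi (slice W k)) = 2" if "k \<in> I" for k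
    using assms(5)[OF that] by (simp add: chi_def)
  then have "card K = 2 * card I" using K(4) by simp
  moreover have "avoids K c" using assms(2) K(1) unfolding avoids_def by blast
  moreover have "finite K" using finite_subset[OF K(2)] fin by simp
  ultimately show False using avoiding_clique_card[OF assms(1) _ K(3)] assms(4) by fastforce
qed

section \<open>The colour neighbourhoods of a vertex\<close>

definition nb :: "nat \<times> nat \<Rightarrow> nat \<Rightarrow> (nat \<times> nat) set" where
  "nb v c = {w. adj v w \<and> col v w = c}"

lemma avoids_nb: "avoids (nb v c) c"
  unfolding avoids_def nb_def using no_triangle by blast

definition link :: "nat \<times> nat \<Rightarrow> nat \<Rightarrow> nat \<Rightarrow> nat set" where
  "link v k c = {l. l < 5 \<and> col v (k, l) = c}"

lemma slice_nb: "i < 6 \<Longrightarrow> j < 5 \<Longrightarrow> k < 6 \<Longrightarrow> k \<noteq> i \<Longrightarrow> slice (nb (i, j) c) k = link (i, j) k c"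
  by (auto simp: slice_def nb_def link_def adj_def)

text \<open>The exceptional case of \<open>chi_avoiding\<close> for the neighbourhood of
  \<open>v\<close> in colour \<open>c\<close>, restricted to the fibers not containing
  \<open>v\<close>.\<close>

definition full :: "nat \<times> nat \<Rightarrow> nat \<Rightarrow> nat set \<Rightarrow> bool" where
  "full v c P \<longleftrightarrow> P \<subseteq> {..<6} - {fst v} \<and> card P = 2 \<and>
     (\<forall>k<6. k \<noteq> fst v \<longrightarrow> (\<forall>l<5. col v (k, l) = c \<longleftrightarrow> k \<in> P))"

lemma fullD: "full (i, j) c P \<Longrightarrow> k < 6 \<Longrightarrow> k \<noteq> i \<Longrightarrow> l < 5 \<Longrightarrow> col (i, j) (k, l) = c \<longleftrightarrow> k \<in> P"
  by (simp add: full_def)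

lemma full_mem: "full (i, j) c P \<Longrightarrow> k \<in> P \<Longrightarrow> k < 6 \<and> k \<noteq> i"
  by (auto simp: full_def)

text \<open>The three colour neighbourhoods need total chromatic number 15 on the other five fibers,
  and 1 more for each colour seen on the own fiber. A colour seen there can supply at most 5, any
  other at most 6. Two colours on the own fiber would need 17 with only 16 available; with one, 16
  are needed, so some colour supplies 6. Writing the vertex as \<open>nxt m\<close> makes
  \<open>m\<close> and \<open>nxt (nxt m)\<close> its neighbours on the cycle.\<close>

lemma vertex_colors:
  assumes "i < 6" "m < 5"
  shows "col (i, nxt m) (i, nxt (nxt m)) = col (i, nxt m) (i, m) \<and>
    (\<exists>c<3. \<exists>P. c \<noteq> col (i, nxt m) (i, m) \<and> full (i, nxt m) c P)"
proof -
  let ?v = "(i, nxt m)"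
  define S where "S c k = slice (nb ?v c) k" for c k
  define s where "s c = (\<Sum>k<6. chi (S c k))" for c
  define p where "p = col ?v (i, nxt (nxt m))"
  define q where "q = col ?v (i, m)"
  have pS: "nxt (nxt m) \<in> S p i" and qS: "m \<in> S q i"
    using assms by (auto simp: S_def slice_def nb_def p_def q_def adj_def)
  have pq: "p < 3" "q < 3" using col_less p_def q_def by auto
  have Si: "nxt m \<notin> S c i" for c
    using adj_irrefl[of ?v ?v] by (auto simp: S_def slice_def nb_def)
  have exact: "s c \<le> 5 \<or> s c = 6 \<and> c \<noteq> p \<and> c \<noteq> q \<and> (\<exists>P. full ?v c P)" if c: "c < 3" for c
  proof (rule disjCI)
    assume "\<not> (s c = 6 \<and> c \<noteq> p \<and> c \<noteq> q \<and> (\<exists>P. full ?v c P))"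
    show "s c \<le> 5"
    proof (rule ccontr)
      assume "\<not> s c \<le> 5"
      then obtain a b where ab: "s c = 6" "a < 6" "b < 6" "a \<noteq> b" "S c a = {..<5}" "S c b = {..<5}"
        "\<forall>k<6. k \<noteq> a \<longrightarrow> k \<noteq> b \<longrightarrow> S c k = {}"
        using chi_avoiding[OF c avoids_nb, of ?v] unfolding s_def S_def by blast
      \<comment> \<open>A vertex is not its own neighbour, so its fiber is not one of the two full
        ones. Its slice is then empty, which rules out \<open>p\<close> and
        \<open>q\<close>.\<close>
      have i: "i \<noteq> a" "i \<noteq> b" using Si[of c] ab(5,6) nxt_less by blast+
      then have "S c i = {}" using ab(7) assms(1) by blast
      then have "c \<noteq> p" "c \<noteq> q" using pS qS by blast+
      moreover have "full ?v c {a, b}"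
      proof -
        have "col ?v (k, l) = c \<longleftrightarrow> k \<in> {a, b}" if "k < 6" "k \<noteq> i" "l < 5" for k l
        proof -
          have "col ?v (k, l) = c \<longleftrightarrow> l \<in> S c k"
            using slice_nb[OF assms(1) nxt_less that(1,2)] that(3) by (simp add: S_def link_def)
          then show ?thesis using ab(5-7) that by auto
        qed
        then show ?thesis using ab i by (auto simp: full_def)
      qed
      ultimately show False using \<open>\<not> (_ \<and> _)\<close> ab(1) by blast
    qed
  qed
  have "chi (S 0 k) + chi (S 1 k) + chi (S 2 k) \<ge> 3" if "k \<in> {..<6} - {i}" for k
  proof (rule chi_cover)
    have "S c k = link ?v k c" for c using slice_nb[OF assms(1) nxt_less] that by (simp add: S_def)
    moreover have "col ?v (k, l) = 0 \<or> col ?v (k, l) = 1 \<or> col ?v (k, l) = 2" for l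
      using col_less[of ?v "(k, l)"] by linarith
    ultimately show "{..<5} \<subseteq> S 0 k \<union> S 1 k \<union> S 2 k" by (auto simp: link_def)
  qed
  then have "(\<Sum>k\<in>{..<6} - {i}. chi (S 0 k) + chi (S 1 k) + chi (S 2 k)) \<ge> (\<Sum>k\<in>{..<6} - {i}. 3)"
    by (rule sum_mono)
  then have "(\<Sum>k\<in>{..<6} - {i}. chi (S 0 k) + chi (S 1 k) + chi (S 2 k)) \<ge> 15"
    using assms(1) by simp
  moreover have "s 0 + s 1 + s 2 = (\<Sum>k<6. chi (S 0 k) + chi (S 1 k) + chi (S 2 k))"
    by (simp add: s_def sum.distrib)
  moreover have "\<dots> = (chi (S 0 i) + chi (S 1 i) + chi (S 2 i)) +
      (\<Sum>k\<in>{..<6} - {i}. chi (S 0 k) + chi (S 1 k) + chi (S 2 k))"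
    using assms(1) by (intro sum.remove) auto
  ultimately have total: "s 0 + s 1 + s 2 \<ge> 15 + (chi (S 0 i) + chi (S 1 i) + chi (S 2 i))"
    by linarith
  have pos: "chi (S p i) \<ge> 1" "chi (S q i) \<ge> 1"
    using chi_eq_0[of "S p i"] chi_eq_0[of "S q i"] pS qS by (auto simp: Suc_le_eq)
  have c3: "c = 0 \<or> c = 1 \<or> c = 2" if "c < 3" for c :: nat using that by linarith
  have e: "s 0 \<le> 5 \<or> s 0 = 6 \<and> 0 \<noteq> p \<and> 0 \<noteq> q" "s 1 \<le> 5 \<or> s 1 = 6 \<and> 1 \<noteq> p \<and> 1 \<noteq> q"
    "s 2 \<le> 5 \<or> s 2 = 6 \<and> 2 \<noteq> p \<and> 2 \<noteq> q"
    using exact[of 0] exact[of 1] exact[of 2] by auto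
  have eq: "p = q"
  proof (rule ccontr)
    assume "p \<noteq> q"
    then show False using c3[OF pq(1)] c3[OF pq(2)] pos e total by auto
  qed
  have "\<exists>c<3. s c = 6"
  proof (rule ccontr)
    assume "\<not> ?thesis"
    then have "s 0 \<noteq> 6" "s 1 \<noteq> 6" "s 2 \<noteq> 6" by auto
    then show False using c3[OF pq(1)] pos e total by auto
  qed
  then show ?thesis using eq exact unfolding p_def q_def by fastforce
qed

section \<open>Fiber colours\<close>

text \<open>The colour of one chosen edge; by \<open>col_fiber\<close> it is the colour of every
  edge of the fiber.\<close>

definition fib :: "nat \<Rightarrow> nat" where "fib i = col (i, 0) (i, 1)"

lemma fib_less: "fib i < 3"
  by (simp add: fib_def col_less)

lemma col_fiber:
  assumes "i < 6" "j < 5"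
  shows "col (i, j) (i, nxt j) = fib i"
proof -
  have step: "col (i, nxt m) (i, nxt (nxt m)) = col (i, m) (i, nxt m)" if "m < 5" for m
    using vertex_colors[OF assms(1) that] col_sym by metis
  have "\<forall>j<5. col (i, j) (i, nxt j) = fib i"
    using step[of 0] step[of 1] step[of 2] step[of 3] unfolding all_less_5 by (simp add: fib_def)
  then show ?thesis using assms(2) by blast
qed

lemma ex_prev: "j < 5 \<Longrightarrow> \<exists>m<5. nxt m = j"
  using all_less_5[of "\<lambda>j. \<exists>m<5. nxt m = j"] unfolding ex_less_5 by simp

lemma ex_full:
  assumes "i < 6" "j < 5"
  shows "\<exists>c<3. \<exists>P. c \<noteq> fib i \<and> full (i, j) c P"
proof -
  obtain m where m: "m < 5" "nxt m = j" using ex_prev[OF assms(2)] by blast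
  have "col (i, nxt m) (i, m) = fib i"
    using col_fiber[OF assms(1) m(1)] col_sym by simp
  then show ?thesis using vertex_colors[OF assms(1) m(1)] m(2) by simp
qed

section \<open>Links between a vertex and another fiber\<close>

lemma link_fib_indep:
  assumes "i < 6" "j < 5" "k < 6" "k \<noteq> i"
  shows "\<not> has_edge (link (i, j) k (fib k))"
proof
  assume "has_edge (link (i, j) k (fib k))"
  then obtain l where l: "l < 5" "col (i, j) (k, l) = fib k" "col (i, j) (k, nxt l) = fib k"
    by (auto simp: has_edge_def link_def)
  show False
    using no_triangle[OF adj_fiber[OF assms(1,3) _ assms(2) l(1)] adj_fiber[OF assms(1,3) _ assms(2) nxt_less]
        adj_nxt[OF assms(3) l(1)] l(2,3) col_fiber[OF assms(3) l(1)]] assms(4) by simp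
qed

text \<open>The vertices of fiber \<open>k\<close> joined to \<open>v\<close> in the fiber's own colour are independent, so for a
  heavy pair those joined in colour \<open>d\<close> form the complement of an independent set of \<open>C5\<close>.\<close>
definition heavy :: "nat \<times> nat \<Rightarrow> nat \<Rightarrow> nat \<Rightarrow> bool" where
  "heavy v k d \<longleftrightarrow> (\<forall>l<5. col v (k, l) = fib k \<or> col v (k, l) = d)"

lemma heavy_has_edge:
  assumes "i < 6" "j < 5" "k < 6" "k \<noteq> i" "heavy (i, j) k d"
  shows "has_edge (link (i, j) k d)"
proof -
  have "{..<5} \<subseteq> link (i, j) k (fib k) \<union> link (i, j) k d"
    using assms(5) by (auto simp: heavy_def link_def)
  then show ?thesis using C5_not_2_colorable link_fib_indep[OF assms(1-4)] by blast
qed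

text \<open>This is heaviness with \<open>d = fib k\<close>, so the same link would both contain an
  edge and be independent.\<close>

lemma not_mono_link:
  assumes "i < 6" "j < 5" "k < 6" "k \<noteq> i" "\<And>l. l < 5 \<Longrightarrow> col (i, j) (k, l) = fib k"
  shows False
  using heavy_has_edge[OF assms(1-4), of "fib k"] link_fib_indep[OF assms(1-4)] assms(5)
  by (auto simp: heavy_def)

text \<open>A vertex of fiber \<open>k\<close> joined in \<open>fib i\<close> to both ends of an
  edge of fiber \<open>i\<close> closes a triangle. Hence each is joined to at least one end in
  \<open>fib k\<close>, and two independent sets would cover the cycle.\<close>

lemma not_adjacent_heavy:
  assumes "i < 6" "j < 5" "k < 6" "k \<noteq> i" "heavy (i, j) k (fib i)" "heavy (i, nxt j) k (fib i)"
  shows False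
proof -
  have "l \<in> link (i, j) k (fib k) \<union> link (i, nxt j) k (fib k)" if l: "l < 5" for l
  proof -
    have "\<not> (col (i, j) (k, l) = fib i \<and> col (i, nxt j) (k, l) = fib i)"
      using no_triangle[OF adj_nxt[OF assms(1,2)] adj_fiber[OF assms(1,3) _ assms(2) l]
          adj_fiber[OF assms(1,3) _ nxt_less l] col_fiber[OF assms(1,2)]] assms(4) by blast
    then show ?thesis using assms(5,6) l by (auto simp: heavy_def link_def)
  qed
  then have "{..<5} \<subseteq> link (i, j) k (fib k) \<union> link (i, nxt j) k (fib k)" by blast
  then show False
    using C5_not_2_colorable link_fib_indep[OF assms(1,2,3,4)] link_fib_indep[OF assms(1) nxt_less assms(3,4)]
    by blast
qed

section \<open>The pair of fibers in a full neighbourhood\<close>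

lemma third_color:
  assumes "a < 3" "b < 3" "c < 3" "a \<noteq> b" "a \<noteq> c" "b \<noteq> c"
  shows "col u v = a \<or> col u v = b \<or> col u v = c" "fib i = a \<or> fib i = b \<or> fib i = c"
  using assms col_less[of u v] fib_less[of i] by linarith+

lemma full_no_edge:
  assumes "i < 6" "j < 5" "full (i, j) c P" "k \<in> P" "k' \<in> P" "k \<noteq> k'" "l < 5" "l' < 5"
  shows "col (k, l) (k', l') \<noteq> c"
proof
  assume c: "col (k, l) (k', l') = c"
  have k: "k < 6" "k \<noteq> i" "k' < 6" "k' \<noteq> i" using full_mem[OF assms(3)] assms(4,5) by auto
  then have "col (i, j) (k, l) = c" "col (i, j) (k', l') = c"
    using fullD[OF assms(3)] assms by auto
  then show False
    using no_triangle[OF adj_fiber adj_fiber adj_fiber _ _ c, of i j] k assms by simp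
qed

lemma full_fib:
  assumes "i < 6" "j < 5" "full (i, j) c P" "k \<in> P"
  shows "fib k \<noteq> c"
proof
  assume "fib k = c"
  moreover have "k < 6" "k \<noteq> i" using full_mem[OF assms(3,4)] by auto
  ultimately show False
    using not_mono_link[OF assms(1,2), of k] fullD[OF assms(3), of k] assms(4) by blast
qed

text \<open>If the colours differed, \<open>c\<close> would be the third colour, which is absent
  between the two fibers. Every vertex of fiber \<open>k\<close> would then be heavy to
  \<open>k'\<close> in the colour of its own fiber, against
  \<open>not_adjacent_heavy\<close>.\<close>

lemma full_fib_eq:
  assumes "i < 6" "j < 5" "c < 3" "full (i, j) c P" "k \<in> P" "k' \<in> P"
  shows "fib k = fib k'"
proof (rule ccontr)
  assume neq: "fib k \<noteq> fib k'"
  then have "k \<noteq> k'" by blast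
  have k: "k < 6" "k' < 6" using full_mem[OF assms(4)] assms(5,6) by auto
  have "heavy (k, l) k' (fib k)" if "l < 5" for l
    unfolding heavy_def
  proof (intro allI impI)
    fix l' :: nat assume "l' < 5"
    then have "col (k, l) (k', l') \<noteq> c"
      using full_no_edge[OF assms(1,2,4-6)] \<open>k \<noteq> k'\<close> that by blast
    then show "col (k, l) (k', l') = fib k' \<or> col (k, l) (k', l') = fib k"
      using third_color(1)[of "fib k" "fib k'" c "(k, l)" "(k', l')"] neq fib_less assms(3)
        full_fib[OF assms(1,2,4,5)] full_fib[OF assms(1,2,4,6)] by blast
  qed
  then show False
    using not_adjacent_heavy[OF k(1) _ k(2), of 0] \<open>k \<noteq> k'\<close> nxt_less by simp
qed

definition cls :: "nat \<Rightarrow> nat set" where "cls g = {k. k < 6 \<and> fib k = g}"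

lemma cls_finite: "finite (cls g)"
  by (simp add: cls_def)

lemma clsD: "k \<in> cls g \<Longrightarrow> k < 6" "k \<in> cls g \<Longrightarrow> fib k = g"
  by (simp_all add: cls_def)

text \<open>The form used for counting: \<open>P\<close> lies in one class and needs two fibers
  there besides \<open>i\<close>, so known class sizes leave few choices of \<open>c\<close> and
  \<open>g\<close>.\<close>

lemma ex_full_cls:
  assumes "i < 6" "j < 5"
  obtains c g P where "c < 3" "g < 3" "c \<noteq> fib i" "c \<noteq> g" "full (i, j) c P" "P \<subseteq> cls g - {i}" "card P = 2"
proof -
  obtain c P where c: "c < 3" "c \<noteq> fib i" "full (i, j) c P" using ex_full[OF assms] by blast
  have P: "card P = 2" "P \<subseteq> {..<6} - {i}" using c(3) by (auto simp: full_def)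
  then obtain k where k: "k \<in> P" by fastforce
  have "P \<subseteq> cls (fib k) - {i}"
    using P(2) full_fib_eq[OF assms c(1,3) _ k] by (auto simp: cls_def)
  then show ?thesis
    using that[of c "fib k" P] c P full_fib[OF assms c(3) k] fib_less by metis
qed

text \<open>Each heavy pair puts an edge of fiber \<open>k\<close> into the
  \<open>d\<close>-neighbourhood, and three such edges are too many for a set avoiding
  \<open>d\<close>.\<close>

lemma three_heavy:
  assumes "i < 6" "j < 5" "d < 3" "I \<subseteq> {..<6} - {i}" "card I \<ge> 3" "\<And>k. k \<in> I \<Longrightarrow> heavy (i, j) k d"
  shows False
proof (rule avoiding_three_edges[OF assms(3) avoids_nb])
  show "I \<subseteq> {..<6}" using assms(4) by blast
  show "has_edge (slice (nb (i, j) d) k)" if "k \<in> I" for k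
  proof -
    have "k < 6" "k \<noteq> i" using that assms(4) by auto
    then show ?thesis
      using heavy_has_edge[OF assms(1,2) _ _ assms(6)[OF that]] slice_nb[OF assms(1,2)] by simp
  qed
qed (fact assms(5))

section \<open>Distributions of the fiber colours\<close>

text \<open>Vertex \<open>(0, 0)\<close> has two full fibers in some colour \<open>c\<close> other
  than \<open>g\<close>. It meets the three remaining fibers only in \<open>g\<close> and the third
  colour, so they are heavy.\<close>

lemma cls_not_all:
  assumes "g < 3" "{..<6} \<subseteq> cls g"
  shows False
proof -
  obtain c P where c: "c < 3" "c \<noteq> fib 0" "full (0, 0) c P"
    using ex_full[of 0 0] by auto
  have fib: "fib k = g" if "k < 6" for k using assms(2) that clsD(2) by blast
  then have "c \<noteq> g" using c(2) by simp
  then obtain e where e: "e < 3" "e \<noteq> g" "e \<noteq> c"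
    using ex_third_color[of g c] by blast
  let ?I = "{..<6} - {0} - P"
  have P: "P \<subseteq> {..<6} - {0}" "card P = 2" using c(3) by (simp_all add: full_def)
  have "card ?I = 3" using card_Diff_subset[OF finite_subset[OF P(1)] P(1)] P(2) by simp
  moreover have "heavy (0, 0) k e" if "k \<in> ?I" for k
  proof -
    have "col (0, 0) (k, l) \<noteq> c" if "l < 5" for l
      using fullD[OF c(3), of k l] \<open>k \<in> ?I\<close> that by simp
    then show ?thesis
      using third_color(1)[of g e c] e assms(1) c(1) \<open>c \<noteq> g\<close> fib[of k] that
      unfolding heavy_def by blast
  qed
  ultimately show False using three_heavy[of 0 0 e ?I] e(1) by auto
qed

lemma cls_card_sum: "card (cls 0) + card (cls 1) + card (cls 2) = 6"
proof -
  have "{..<6} = cls 0 \<union> cls 1 \<union> cls 2"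
    using fib_less by (auto simp: cls_def) (metis One_nat_def less_2_cases less_Suc_eq numeral_2_eq_2 numeral_3_eq_3)
  moreover have "card (cls 0 \<union> cls 1 \<union> cls 2) = card (cls 0) + card (cls 1) + card (cls 2)"
    by (subst card_Un_disjoint; (subst card_Un_disjoint)?; auto simp: cls_def)
  ultimately show ?thesis by (metis card_lessThan)
qed

text \<open>A vertex outside the class of colour \<open>g\<close> is heavy to all fibers of the class except two. For
  adjacent vertices of a fiber the exceptional pairs are complementary, so they would properly
  2-colour the 5-cycle.\<close>
lemma cls_card_le_3:
  assumes "g < 3" "i < 6" "fib i \<noteq> g"
  shows "card (cls g) \<le> 3"
proof (rule ccontr)
  assume "\<not> ?thesis"
  then have card: "card (cls g) \<ge> 4" by simp
  have "\<exists>P. P \<subseteq> cls g \<and> card P = 2 \<and> (\<forall>k\<in>cls g - P. heavy (i, j) k (fib i))" if j: "j < 5" for j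
  proof -
    obtain c h P where c: "c < 3" "h < 3" "c \<noteq> fib i" "c \<noteq> h" "full (i, j) c P" "P \<subseteq> cls h - {i}" "card P = 2"
      using ex_full_cls[OF assms(2) j] .
    \<comment> \<open>Otherwise the class of at least 4, the two fibers of \<open>P\<close> and the
      fiber \<open>i\<close> would be at least 7 distinct fibers.\<close>
    have "h = g"
    proof (rule ccontr)
      assume "h \<noteq> g"
      then have "cls g \<inter> insert i P = {}" using c(6) assms(3) by (auto simp: cls_def)
      moreover have "finite P" using finite_subset[OF c(6)] cls_finite by blast
      moreover have "i \<notin> P" using c(6) by blast
      ultimately have "card (cls g \<union> insert i P) = card (cls g) + 3"
        using c(7) cls_finite by (simp add: card_Un_disjoint)
      moreover have "cls g \<union> insert i P \<subseteq> {..<6}" using c(6) assms(2) by (auto simp: cls_def)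
      then have "card (cls g \<union> insert i P) \<le> 6" using card_mono[of "{..<6::nat}"] by simp
      ultimately show False using card by linarith
    qed
    have "heavy (i, j) k (fib i)" if k: "k \<in> cls g - P" for k
      unfolding heavy_def
    proof (intro allI impI)
      fix l :: nat assume "l < 5"
      moreover have "k < 6" "fib k = g" using k clsD by blast+
      ultimately have "col (i, j) (k, l) \<noteq> c" using fullD[OF c(5)] k assms(3) by blast
      then show "col (i, j) (k, l) = fib k \<or> col (i, j) (k, l) = fib i"
        using third_color(1)[of g "fib i" c] assms fib_less c(1,3,4) \<open>h = g\<close> \<open>fib k = g\<close> by metis
    qed
    then show ?thesis using c(6,7) \<open>h = g\<close> by blast
  qed
  then obtain P where P: "\<And>j. j < 5 \<Longrightarrow> P j \<subseteq> cls g" "\<And>j. j < 5 \<Longrightarrow> card (P j) = 2"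
    "\<And>j k. j < 5 \<Longrightarrow> k \<in> cls g - P j \<Longrightarrow> heavy (i, j) k (fib i)"
    by metis
  \<comment> \<open>No fiber of the class is heavy to both ends of an edge, so two exceptional pairs
    cover at least four fibers and must be disjoint.\<close>
  have disj: "P j \<inter> P (nxt j) = {} \<and> cls g = P j \<union> P (nxt j)" if j: "j < 5" for j
  proof -
    have sub: "cls g \<subseteq> P j \<union> P (nxt j)"
    proof
      fix k assume k: "k \<in> cls g"
      then have "k < 6" "k \<noteq> i" using assms(3) clsD by auto
      then show "k \<in> P j \<union> P (nxt j)"
        using not_adjacent_heavy[OF assms(2) j, of k] P(3)[OF j] P(3)[OF nxt_less] k by blast
    qed
    then have eq: "cls g = P j \<union> P (nxt j)" using P(1)[OF j] P(1)[OF nxt_less] by blast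
    have fin: "finite (P j)" "finite (P (nxt j))"
      using P(1)[OF j] P(1)[OF nxt_less] cls_finite finite_subset by blast+
    have "card (P j \<union> P (nxt j)) + card (P j \<inter> P (nxt j)) = 4"
      using card_Un_Int[OF fin] P(2)[OF j] P(2)[OF nxt_less] by simp
    then have "card (P j \<inter> P (nxt j)) = 0" using eq card by simp
    then show ?thesis using eq fin by simp
  qed
  obtain k where k: "k \<in> cls g" using card by fastforce
  have "\<forall>j<5. k \<in> P j \<longleftrightarrow> k \<notin> P (nxt j)" using disj k by blast
  then show False unfolding all_less_5 nxt_simps by blast
qed

text \<open>A vertex of class \<open>a\<close> sends \<open>b\<close> to the other two fibers of its
  class, or \<open>z\<close> to two fibers of class \<open>b\<close>. Once the first type is
  excluded, \<open>z\<close> does not occur inside class \<open>a\<close>, whose three fibers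
  contain a clique of size 6.\<close>

lemma cls_cards_not_3_3:
  assumes "a < 3" "b < 3" "z < 3" "a \<noteq> b" "a \<noteq> z" "b \<noteq> z" "card (cls a) = 3" "card (cls b) = 3" "card (cls z) = 0"
  shows False
proof -
  have type: "full (i, j) b (cls a - {i}) \<or> (\<exists>P \<subseteq> cls b. full (i, j) z P)"
    if i: "i \<in> cls a" and j: "j < 5" for i j
  proof -
    have i6: "i < 6" and fi: "fib i = a" using clsD i by blast+
    obtain c g P where c: "c < 3" "g < 3" "c \<noteq> fib i" "c \<noteq> g" "full (i, j) c P" "P \<subseteq> cls g - {i}" "card P = 2"
      using ex_full_cls[OF i6 j] .
    have "cls z = {}" using assms(9) cls_finite by simp
    then have "g \<noteq> z" using c(6,7) by auto
    then consider "g = a" | "g = b" using third_color(2) c(2) assms(1-6) by linarith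
    then show ?thesis
    proof cases
      case 1
      then have "P = cls a - {i}"
        using c(6,7) i assms(7) cls_finite by (intro card_subset_eq) auto
      \<comment> \<open>Otherwise class \<open>b\<close> would be met only in \<open>a\<close> and
        \<open>b\<close>, giving three heavy fibers.\<close>
      have "c \<noteq> z"
      proof
        assume "c = z"
        have "heavy (i, j) k a" if k: "k \<in> cls b" for k
          unfolding heavy_def
        proof (intro allI impI)
          fix l :: nat assume "l < 5"
          moreover have kb: "k < 6" "fib k = b" using clsD k by blast+
          moreover have "k \<notin> P" using c(6) 1 kb(2) assms(4) clsD(2) by blast
          ultimately have "col (i, j) (k, l) \<noteq> z"
            using fullD[OF c(5)] \<open>c = z\<close> fi assms(4) by blast
          then show "col (i, j) (k, l) = fib k \<or> col (i, j) (k, l) = a"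
            using third_color(1)[OF assms(1-6)] kb(2) by blast
        qed
        moreover have "cls b \<subseteq> {..<6} - {i}" using fi assms(4) by (auto simp: cls_def)
        ultimately show False using three_heavy[OF i6 j assms(1), of "cls b"] assms(8) by simp
      qed
      then have "c = b" using c(1,3) fi assms(1-6) by linarith
      then show ?thesis using c(5) \<open>P = _\<close> by blast
    next
      case 2
      then have "c = z" using c(1,3,4) fi assms(1-6) by linarith
      then show ?thesis using c(5,6) 2 by blast
    qed
  qed
  have only_z: "\<exists>P \<subseteq> cls b. full (i, j) z P" if i: "i \<in> cls a" and j: "j < 5" for i j
  proof (rule ccontr)
    assume "\<not> ?thesis"
    \<comment> \<open>Colour \<open>b\<close> is now impossible between \<open>k\<close> and
      \<open>k'\<close>, so \<open>(k, 0)\<close> is of the second type and sends no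
      \<open>z\<close> to \<open>k'\<close> either. Only the colour of \<open>k'\<close> itself
      remains, against \<open>not_mono_link\<close>.\<close>
    then have full: "full (i, j) b (cls a - {i})" using type[OF i j] by blast
    have "card (cls a - {i}) = 2" using i assms(7) cls_finite by simp
    then obtain k k' where k: "cls a - {i} = {k, k'}" "k \<noteq> k'" by (meson card_2_iff)
    then have ka: "k \<in> cls a" "k' \<in> cls a" "k \<noteq> i" "k' \<noteq> i" by blast+
    have lt: "i < 6" "k < 6" "k' < 6" using ka i clsD by blast+
    have nob: "col (k, 0) (k', l) \<noteq> b" if "l < 5" for l
      using full_no_edge[OF lt(1) j full, of k k' 0 l] k that by simp
    show False
    proof (cases "full (k, 0) b (cls a - {k})")
      case True
      then have "col (k, 0) (k', 0) = b" using fullD[OF True, of k' 0] lt ka k(2) by simp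
      then show False using nob[of 0] by simp
    next
      case False
      then obtain P where P: "P \<subseteq> cls b" "full (k, 0) z P" using type[OF ka(1), of 0] by auto
      have "k' \<notin> P" using P(1) ka(2) assms(4) clsD(2) by blast
      then have "col (k, 0) (k', l) \<noteq> z" if "l < 5" for l
        using fullD[OF P(2) lt(3) _ that] k(2) by simp
      then have "col (k, 0) (k', l) = fib k'" if "l < 5" for l
        using third_color(1)[OF assms(1-6)] nob clsD(2)[OF ka(2)] that by metis
      then show False using not_mono_link[of k 0 k'] lt k(2) by simp
    qed
  qed
  let ?W = "cls a \<times> {..<5}"
  have "avoids ?W z"
    unfolding avoids_def
  proof (intro ballI impI)
    fix u v assume uv: "u \<in> ?W" "v \<in> ?W" "adj u v"
    obtain i j k l where eq: "u = (i, j)" "v = (k, l)" by (metis surj_pair)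
    have mem: "i \<in> cls a" "k \<in> cls a" "j < 5" "l < 5" using uv eq by auto
    show "col u v \<noteq> z"
    proof (cases "i = k")
      case True
      then have "col u v = a"
        using uv(3) mem col_fiber[of i j] col_fiber[of i l] col_sym[of u v] clsD[OF mem(1)] eq
        by (auto simp: adj_def)
      then show ?thesis using assms(5) by simp
    next
      case False
      obtain P where P: "P \<subseteq> cls b" "full (i, j) z P" using only_z[OF mem(1,3)] by blast
      have "k \<notin> P" using P(1) mem(2) assms(4) clsD(2) by blast
      then show ?thesis using fullD[OF P(2), of k l] mem(2,4) clsD(1) False eq by auto
    qed
  qed
  then show False
  proof (rule avoiding_three_edges[OF assms(3)])
    show "cls a \<subseteq> {..<6}" by (auto simp: cls_def)
    show "has_edge (slice ?W k)" if "k \<in> cls a" for k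
      using that unfolding has_edge_def by (intro exI[of _ 0]) (simp add: slice_def)
  qed (use assms(7) in simp)
qed

text \<open>By size, a vertex of class \<open>b\<close> sends \<open>z\<close> to two fibers
  \<open>k\<close>, \<open>k'\<close> of class \<open>a\<close>, so \<open>z\<close> is absent
  between these. Each possible type of a vertex in the third fiber \<open>h\<close> of class
  \<open>a\<close> then fails.\<close>

lemma cls_cards_not_3_2_1:
  assumes "a < 3" "b < 3" "z < 3" "a \<noteq> b" "a \<noteq> z" "b \<noteq> z" "card (cls a) = 3" "card (cls b) = 2" "card (cls z) = 1"
  shows False
proof -
  have type_b: "\<exists>P. full (i, j) z P \<and> P \<subseteq> cls a \<and> card P = 2" if i: "i \<in> cls b" and j: "j < 5" for i j
  proof -
    have i6: "i < 6" and fi: "fib i = b" using clsD i by blast+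
    obtain c g P where c: "c < 3" "g < 3" "c \<noteq> fib i" "c \<noteq> g" "full (i, j) c P" "P \<subseteq> cls g - {i}" "card P = 2"
      using ex_full_cls[OF i6 j] .
    \<comment> \<open>Class \<open>b\<close> without \<open>i\<close> and class \<open>z\<close>
      have one fiber each, too few to hold \<open>P\<close>.\<close>
    have "card P \<le> card (cls g - {i})" using c(6) cls_finite by (intro card_mono) auto
    then have "g \<noteq> b" "g \<noteq> z"
      using c(7) i assms(8,9) cls_finite card_Diff1_le[of "cls z" i] by auto
    then have "g = a" using c(2) assms(1-6) by linarith
    then have "c = z" using c(1,3,4) fi assms(1-6) by linarith
    then show ?thesis using c(5-7) \<open>g = a\<close> by blast
  qed
  have type_a: "full (i, j) z (cls a - {i}) \<or> full (i, j) b (cls a - {i}) \<or> full (i, j) z (cls b)"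
    if i: "i \<in> cls a" and j: "j < 5" for i j
  proof -
    have i6: "i < 6" and fi: "fib i = a" using clsD i by blast+
    obtain c g P where c: "c < 3" "g < 3" "c \<noteq> fib i" "c \<noteq> g" "full (i, j) c P" "P \<subseteq> cls g - {i}" "card P = 2"
      using ex_full_cls[OF i6 j] .
    have "card P \<le> card (cls g)" using c(6) cls_finite by (intro card_mono) auto
    then have "g \<noteq> z" using c(7) assms(9) by auto
    then consider "g = a" | "g = b" using c(2) assms(1-6) by linarith
    then show ?thesis
    proof cases
      case 1
      then have "P = cls a - {i}"
        using c(6,7) i assms(7) cls_finite by (intro card_subset_eq) auto
      moreover have "c = b \<or> c = z" using c(1,3) fi assms(1-6) by linarith
      ultimately show ?thesis using c(5) by blast
    next
      case 2
      then have "P = cls b" using c(6,7) assms(8) cls_finite by (intro card_subset_eq) auto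
      moreover have "c = z" using c(1,3,4) fi 2 assms(1-6) by linarith
      ultimately show ?thesis using c(5) by blast
    qed
  qed
  obtain i where i: "i \<in> cls b" using assms(8) by fastforce
  obtain P where P: "full (i, 0) z P" "P \<subseteq> cls a" "card P = 2" using type_b[OF i, of 0] by auto
  obtain k k' where k: "P = {k, k'}" "k \<noteq> k'" using P(3) by (meson card_2_iff)
  have "card (cls a - P) = 1" using card_Diff_subset[OF finite_subset[OF P(2) cls_finite] P(2)] P(3) assms(7) by simp
  then obtain h where h: "cls a - P = {h}" by (meson card_1_singletonE)
  have a: "cls a = {h, k, k'}" "h \<noteq> k" "h \<noteq> k'" using h k P(2) by blast+
  have mem: "h \<in> cls a" "k \<in> cls a" "k' \<in> cls a" using a by blast+
  have lt: "h < 6" "k < 6" "k' < 6" "i < 6" using mem i clsD by blast+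
  have ib: "i \<noteq> h" "i \<noteq> k" "i \<noteq> k'" using mem i assms(4) clsD(2) by blast+
  have h_cls_b: "h \<notin> cls b" using mem(1) assms(4) clsD(2) by blast
  have no_z: "col (k, 0) (k', l) \<noteq> z" if "l < 5" for l
    using full_no_edge[OF lt(4) _ P(1), of k k' 0 l] k that by simp
  have ih: "col (i, 0) (h, 0) \<noteq> z" using fullD[OF P(1) lt(1), of 0] ib a k by simp
  consider "full (h, 0) z (cls a - {h})" | "full (h, 0) b (cls a - {h})" | "full (h, 0) z (cls b)"
    using type_a[OF mem(1), of 0] by auto
  then show False
  proof cases
    case 1
    then have "col (h, 0) (k, 0) = z" using fullD[OF 1 lt(2), of 0] a mem by simp
    then have hk: "col (k, 0) (h, 0) = z" using col_sym by simp
    \<comment> \<open>Every type of \<open>(k, 0)\<close> contradicts either \<open>hk\<close> or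
      the absence of \<open>z\<close> between \<open>k\<close> and \<open>k'\<close>.\<close>
    consider "full (k, 0) z (cls a - {k})" | "full (k, 0) b (cls a - {k})" | "full (k, 0) z (cls b)"
      using type_a[OF mem(2), of 0] by auto
    then show False
    proof cases
      case 1
      then show False using fullD[OF 1 lt(3), of 0] no_z[of 0] k(2) mem by simp
    next
      case 2
      then show False using fullD[OF 2 lt(1), of 0] hk a mem assms(6) by simp
    next
      case 3
      then show False using fullD[OF 3 lt(1), of 0] hk a h_cls_b by simp
    qed
  next
    case 2
    \<comment> \<open>Between \<open>k\<close> and \<open>k'\<close>, the vertex in \<open>h\<close>
      excludes \<open>b\<close> and the one in \<open>i\<close> excludes \<open>z\<close>, leaving
      only their own colour.\<close>
    have no_b: "col (k, 0) (k', l) \<noteq> b" if "l < 5" for l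
      using full_no_edge[OF lt(1) _ 2, of k k' 0 l] mem a k(2) that by simp
    have "col (k, 0) (k', l) = fib k'" if "l < 5" for l
      using third_color(1)[OF assms(1-6)] no_b no_z clsD(2)[OF mem(3)] that by metis
    then show False using not_mono_link[of k 0 k'] lt k(2) by simp
  next
    case 3
    then have "col (h, 0) (i, 0) = z" using fullD[OF 3 lt(4), of 0] i ib by simp
    then show False using ih col_sym by metis
  qed
qed

text \<open>A vertex of class \<open>p\<close> sends one of the other two colours to the whole class
  of the remaining one. If it sends \<open>r\<close> to class \<open>q\<close>, a vertex
  \<open>y\<close> of class \<open>r\<close> sends \<open>q\<close> to class \<open>p\<close> or
  \<open>p\<close> to class \<open>q\<close>. In either case some vertex of the class reached by
  \<open>y\<close> can meet the other fiber of that class only in the class colour.\<close>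

lemma cls_cards_not_2_2_2:
  assumes "a < 3" "b < 3" "z < 3" "a \<noteq> b" "a \<noteq> z" "b \<noteq> z" "card (cls a) = 2" "card (cls b) = 2" "card (cls z) = 2"
  shows False
proof -
  have type: "full (i, j) r (cls q) \<or> full (i, j) q (cls r)"
    if i: "i \<in> cls p" and j: "j < 5" and
      pqr: "p < 3" "q < 3" "r < 3" "p \<noteq> q" "p \<noteq> r" "q \<noteq> r" "card (cls p) = 2" "card (cls q) = 2" "card (cls r) = 2"
    for i j p q r
  proof -
    have i6: "i < 6" and fi: "fib i = p" using clsD i by blast+
    obtain c g P where c: "c < 3" "g < 3" "c \<noteq> fib i" "c \<noteq> g" "full (i, j) c P" "P \<subseteq> cls g - {i}" "card P = 2"
      using ex_full_cls[OF i6 j] .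
    have "card P \<le> card (cls g - {i})" using c(6) cls_finite by (intro card_mono) auto
    then have "g \<noteq> p" using c(7) i pqr(7) cls_finite by auto
    then have g: "g = q \<and> c = r \<or> g = r \<and> c = q" using c(1-4) fi pqr(1-6) by linarith
    then have "card (cls g) = 2" using pqr(8,9) by blast
    then have "P = cls g" using c(6,7) cls_finite by (intro card_subset_eq) auto
    then show ?thesis using g c(5) by blast
  qed
  have no: False
    if i: "i \<in> cls p" and full: "full (i, 0) r (cls q)" and
      pqr: "p < 3" "q < 3" "r < 3" "p \<noteq> q" "p \<noteq> r" "q \<noteq> r" "card (cls p) = 2" "card (cls q) = 2" "card (cls r) = 2"
    for i p q r
  proof -
    have "card (cls p - {i}) = 1" using i pqr(7) cls_finite by simp
    then obtain i' where i': "cls p - {i} = {i'}" by (meson card_1_singletonE)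
    then have ip: "i' \<in> cls p" "i \<noteq> i'" by blast+
    obtain k k' where k: "cls q = {k, k'}" "k \<noteq> k'" using pqr(8) by (meson card_2_iff)
    then have kq: "k \<in> cls q" "k' \<in> cls q" by blast+
    obtain y where y: "y \<in> cls r" using pqr(9) by fastforce
    have lt: "i < 6" "i' < 6" "k < 6" "k' < 6" "y < 6" using i ip kq y clsD by blast+
    have "full (y, 0) q (cls p) \<or> full (y, 0) p (cls q)"
      using type[OF y, of 0 p q] pqr by auto
    then show False
    proof
      assume f: "full (y, 0) q (cls p)"
      have "i' \<notin> cls q" using ip(1) pqr(4) clsD(2) by blast
      then have "col (i, 0) (i', l) \<noteq> r" if "l < 5" for l
        using fullD[OF full lt(2) _ that] ip(2) by simp
      moreover have "col (i, 0) (i', l) \<noteq> q" if "l < 5" for l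
        using full_no_edge[OF lt(5) _ f i ip(1), of 0 l] ip(2) that by simp
      ultimately have "col (i, 0) (i', l) = fib i'" if "l < 5" for l
        using third_color(1)[OF pqr(1-6)] clsD(2)[OF ip(1)] that by metis
      then show False using not_mono_link[of i 0 i'] lt ip(2) by simp
    next
      assume f: "full (y, 0) p (cls q)"
      have "col (k, 0) (k', l) \<noteq> r" if "l < 5" for l
        using full_no_edge[OF lt(1) _ full kq, of 0 l] k(2) that by simp
      moreover have "col (k, 0) (k', l) \<noteq> p" if "l < 5" for l
        using full_no_edge[OF lt(5) _ f kq, of 0 l] k(2) that by simp
      ultimately have "col (k, 0) (k', l) = fib k'" if "l < 5" for l
        using third_color(1)[OF pqr(1-6)] clsD(2)[OF kq(2)] that by metis
      then show False using not_mono_link[of k 0 k'] lt k(2) by simp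
    qed
  qed
  obtain i where i: "i \<in> cls a" using assms(7) by fastforce
  \<comment> \<open>The two types are mirror images: the second use of \<open>no\<close> exchanges
    \<open>b\<close> and \<open>z\<close>.\<close>
  show False
    using type[OF i _ assms, of 0] no[OF i _ assms] no[OF i, of b z] assms by auto
qed

text \<open>Sizes at most 3 with sum 6 are 3+3+0, 3+2+1 or 2+2+2 up to order; each order is a
  separate instance of the corresponding lemma.\<close>

lemma no_triangle_free_coloring: False
proof -
  have le3: "card (cls g) \<le> 3" if "g < 3" for g
  proof (cases "\<exists>i<6. fib i \<noteq> g")
    case True
    then show ?thesis using cls_card_le_3[OF that] by blast
  next
    case False
    then show ?thesis using cls_not_all[OF that] by (auto simp: cls_def)
  qed
  define n where "n g = card (cls g)" for g
  have sum: "n 0 + n 1 + n 2 = 6" and n: "n 0 \<le> 3" "n 1 \<le> 3" "n 2 \<le> 3"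
    using cls_card_sum le3[of 0] le3[of 1] le3[of 2] by (simp_all add: n_def)
  have c33: "\<not> (n a = 3 \<and> n b = 3 \<and> n z = 0)" and c321: "\<not> (n a = 3 \<and> n b = 2 \<and> n z = 1)"
    and c222: "\<not> (n a = 2 \<and> n b = 2 \<and> n z = 2)"
    if "a < 3" "b < 3" "z < 3" "a \<noteq> b" "a \<noteq> z" "b \<noteq> z" for a b z
    using cls_cards_not_3_3[OF that] cls_cards_not_3_2_1[OF that] cls_cards_not_2_2_2[OF that]
    unfolding n_def by blast+
  have "\<not> (n 0 = 3 \<and> n 1 = 3 \<and> n 2 = 0)" "\<not> (n 0 = 3 \<and> n 2 = 3 \<and> n 1 = 0)"
    "\<not> (n 1 = 3 \<and> n 2 = 3 \<and> n 0 = 0)"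
    by (rule c33; simp)+
  moreover have "\<not> (n 0 = 3 \<and> n 1 = 2 \<and> n 2 = 1)" "\<not> (n 0 = 3 \<and> n 2 = 2 \<and> n 1 = 1)"
    "\<not> (n 1 = 3 \<and> n 0 = 2 \<and> n 2 = 1)" "\<not> (n 1 = 3 \<and> n 2 = 2 \<and> n 0 = 1)"
    "\<not> (n 2 = 3 \<and> n 0 = 2 \<and> n 1 = 1)" "\<not> (n 2 = 3 \<and> n 1 = 2 \<and> n 0 = 1)"
    by (rule c321; simp)+
  moreover have "\<not> (n 0 = 2 \<and> n 1 = 2 \<and> n 2 = 2)"
    by (rule c222; simp)
  moreover have "n 0 = 0 \<or> n 0 = 1 \<or> n 0 = 2 \<or> n 0 = 3" "n 1 = 0 \<or> n 1 = 1 \<or> n 1 = 2 \<or> n 1 = 3"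
    using n by linarith+
  ultimately show False using sum n by (elim disjE) simp_all
qed

end

section \<open>Edges of the Zykov power\<close>

lemma verts_C5: "verts C5 = {..<5}"
  by (auto simp: verts_def C5_def)

lemma edges_C5: "j < 5 \<Longrightarrow> {j, nxt j} \<in> edges C5"
  by (auto simp: edges_def C5_def nxt_def)

lemma verts_zykov_power: "verts (zykov_power n G) = {..<n} \<times> verts G"
  by (induction n) (auto simp: verts_def zykov_sum_def tag_copy_def less_Suc_eq)

text \<open>The edge arises when copy \<open>k\<close>, the later of the two, is added; further
  steps preserve it.\<close>

lemma zykov_power_cross_edge:
  "i < k \<Longrightarrow> k < n \<Longrightarrow> x \<in> verts G \<Longrightarrow> y \<in> verts G \<Longrightarrow> {(i, x), (k, y)} \<in> edges (zykov_power n G)"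
proof (induction n)
  case (Suc n)
  have e: "edges (zykov_power (Suc n) G) = edges (zykov_power n G) \<union> edges (tag_copy n G) \<union>
    {{u, v} | u v. u \<in> verts (zykov_power n G) \<and> v \<in> verts (tag_copy n G)}"
    by (simp add: edges_def zykov_sum_def)
  show ?case
  proof (cases "k = n")
    case True
    have "(i, x) \<in> verts (zykov_power n G)" using Suc.prems True by (simp add: verts_zykov_power)
    moreover have "(k, y) \<in> verts (tag_copy n G)"
      using Suc.prems True by (simp add: tag_copy_def verts_def)
    ultimately show ?thesis unfolding e by blast
  next
    case False
    then show ?thesis using Suc unfolding e by simp
  qed
qed simp

lemma zykov_power_fiber_edge:
  "i < n \<Longrightarrow> {x, y} \<in> edges G \<Longrightarrow> {(i, x), (i, y)} \<in> edges (zykov_power n G)"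
proof (induction n)
  case (Suc n)
  have e: "edges (zykov_power (Suc n) G) = edges (zykov_power n G) \<union> edges (tag_copy n G) \<union>
    {{u, v} | u v. u \<in> verts (zykov_power n G) \<and> v \<in> verts (tag_copy n G)}"
    by (simp add: edges_def zykov_sum_def)
  show ?case
  proof (cases "i = n")
    case True
    have "Pair n ` {x, y} \<in> edges (tag_copy n G)"
      using imageI[OF Suc.prems(2), of "image (Pair n)"] by (simp only: tag_copy_def edges_def snd_conv)
    then have "{(i, x), (i, y)} \<in> edges (tag_copy n G)" using True by simp
    then show ?thesis unfolding e by blast
  next
    case False
    then show ?thesis using Suc unfolding e by simp
  qed
qed simp

lemma adj_edge:
  assumes "adj u v"
  shows "{u, v} \<in> edges (zykov_power 6 C5)"
proof -
  obtain i j k l where eq: "u = (i, j)" "v = (k, l)" by (metis surj_pair)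
  have lt: "i < 6" "k < 6" "j < 5" "l < 5" and a: "i \<noteq> k \<or> l = nxt j \<or> j = nxt l"
    using assms eq by (auto simp: adj_def)
  consider "i < k" | "k < i" | "i = k" "l = nxt j \<or> j = nxt l" using a by linarith
  then show ?thesis
  proof cases
    case 1
    then show ?thesis using zykov_power_cross_edge[of i k 6 j C5 l] lt eq by (simp add: verts_C5)
  next
    case 2
    then show ?thesis
      using zykov_power_cross_edge[of k i 6 l C5 j] lt eq by (simp add: verts_C5 insert_commute)
  next
    case 3
    then have "{j, l} \<in> edges C5" using edges_C5[OF lt(3)] edges_C5[OF lt(4)] by (metis insert_commute)
    then show ?thesis using zykov_power_fiber_edge[of i 6 j l C5] lt(1) eq 3(1) by simp
  qed
qed

theorem mainTheorem1:
  shows "edge_arrows (zykov_power 6 C5) [3, 3, 3]"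
proof (rule ccontr)
  assume "\<not> ?thesis"
  then obtain c :: "(nat \<times> nat) set \<Rightarrow> nat"
    where c: "\<forall>e\<in>edges (zykov_power 6 C5). c e < length [3, 3, 3 :: nat]"
    and no_clique: "\<not> (\<exists>i < length [3, 3, 3 :: nat]. \<exists>K \<subseteq> verts (zykov_power 6 C5). card K = [3, 3, 3] ! i \<and>
      (\<forall>u\<in>K. \<forall>v\<in>K. u \<noteq> v \<longrightarrow> {u, v} \<in> edges (zykov_power 6 C5) \<and> c {u, v} = i))"
    unfolding edge_arrows_def by blast
  have nth: "[3, 3, 3] ! i = (3::nat)" if "i < 3" for i
    using that by (auto simp: less_Suc_eq numeral_3_eq_3)
  have no: False if "d < 3" "K \<subseteq> verts (zykov_power 6 C5)" "card K = 3"
    "\<forall>u\<in>K. \<forall>v\<in>K. u \<noteq> v \<longrightarrow> {u, v} \<in> edges (zykov_power 6 C5) \<and> c {u, v} = d" for d K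
  proof -
    have "d < length [3, 3, 3 :: nat]" "card K = [3, 3, 3] ! d" using that(1,3) nth by simp_all
    then show False using no_clique that(2,4) by blast
  qed
  have c_mod: "c {u, v} mod 3 = c {u, v}" if "adj u v" for u v
    using bspec[OF c adj_edge[OF that]] by simp
  \<comment> \<open>Reduction modulo 3 bounds the colour on all pairs, as the locale demands, and by
    \<open>c_mod\<close> changes nothing on edges.\<close>
  interpret triangle_free_coloring "\<lambda>u v. c {u, v} mod 3"
  proof
    fix u v w d
    assume a: "adj u v" "adj u w" "adj v w"
      and "c {u, v} mod 3 = d" "c {u, w} mod 3 = d" "c {v, w} mod 3 = d"
    then have d: "c {u, v} = d" "c {u, w} = d" "c {v, w} = d" using c_mod by simp_all
    have "d < 3" using bspec[OF c adj_edge[OF a(1)]] d(1) by simp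
    then show False
    proof (rule no[of d "{u, v, w}"])
      show "{u, v, w} \<subseteq> verts (zykov_power 6 C5)"
        using a by (cases u; cases v; cases w) (auto simp: verts_zykov_power verts_C5 adj_def)
      show "card {u, v, w} = 3" using a adj_irrefl by (auto simp: card_3_iff)
      show "\<forall>x\<in>{u, v, w}. \<forall>y\<in>{u, v, w}. x \<noteq> y \<longrightarrow>
          {x, y} \<in> edges (zykov_power 6 C5) \<and> c {x, y} = d"
        using d adj_edge[OF a(1)] adj_edge[OF a(2)] adj_edge[OF a(3)] by (auto simp: insert_commute)
    qed
  qed (simp_all add: insert_commute)
  show False by (rule no_triangle_free_coloring)
qed

end
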